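(* Let $(S,T)$ be a connected stripped triangulated surface with edge set $E$, and let $h\in\mathbb{R}$. If $d_1,d_2:E\to\mathbb{R}_{+}$ are two hyperbolic polyhedral metrics on $(S,T)$ with the same boundary value and the same $\phi_h$-curvature on every interior edge, then $d_1=d_2$.
   Context: A bordered triangulated surface $(S,T)$ is a compact surface $S$ with non-empty boundary together with a (finite) triangulation $T$; $E$ is its set of edges. An edge is a boundary edge if it belongs to the boundary of $S$, and an interior edge otherwise; $E_{\partial}$ is the set of boundary edges. The triangulated surface $(S,T)$ is called stripped if every triangle of $T$ has at least one boundary edge. A hyperbolic polyhedral metric on $(S,T)$ is a function $d:E\to\mathbb{R}_{+}$ such that for every triangle of $T$ the $d$-values of its three edges satisfy the strict triangle inequalities; each triangle is then given the geometry of the hyperbolic triangle with those edge lengths. "Determined up to isometry" means that the function $d$ is determined. The boundary value of $d$ is the restriction $d|_{E_{\partial}}$. For an interior edge $e$, let $a,a'$ be the inner angles facing $e$ in the two triangles adjacent to $e$. For $h\in\mathbb{R}$ the $\phi_h$-curvature at $e$ is $$\phi_h(e)=\int_a^{\pi/2}\sin^h t\,dt+\int_{a'}^{\pi/2}\sin^h t\,dt.$$ *)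

theory Defs
  imports "HOL-Analysis.Analysis" "HOL-Homology.Homology"
begin

section \<open>Compact surfaces with boundary\<close>

definition half_plane :: "(real \<times> real) set" where
  "half_plane = {p. 0 \<le> snd p}"

text \<open>Second countability is omitted, as it follows from compactness and the existence of charts.\<close>

definition compact_surface :: "'s topology \<Rightarrow> bool" where
  "compact_surface S \<longleftrightarrow>
     compact_space S \<and> Hausdorff_space S \<and>
     (\<forall>x\<in>topspace S. \<exists>U V. openin S U \<and> x \<in> U \<and> openin (top_of_set half_plane) V \<and>
        subtopology S U homeomorphic_space top_of_set V)"

text \<open>The boundary is the manifold boundary, not the frontier of a set: the points without a
  neighbourhood homeomorphic to an open subset of the plane.\<close>

definition surface_boundary :: "'s topology \<Rightarrow> 's set" where
  "surface_boundary S =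
     {x \<in> topspace S. \<nexists>U V. openin S U \<and> x \<in> U \<and> open (V :: (real \<times> real) set) \<and>
        subtopology S U homeomorphic_space top_of_set V}"

section \<open>Triangulations\<close>

text \<open>A triangle of a triangulation is given by its characteristic map, a singular
  2-simplex; the triangulation is the finite set of these maps. The open faces of the
  standard 2-simplex are indexed by the nonempty subsets of \<open>{0, 1, 2}\<close>.\<close>

definition open_face :: "nat set \<Rightarrow> (nat \<Rightarrow> real) set" where
  "open_face J = {x \<in> standard_simplex 2. \<forall>i\<le>2. 0 < x i \<longleftrightarrow> i \<in> J}"

text \<open>The images of the open faces are the open cells (vertices, open edges and open triangles).
  Two open cells are disjoint, or they coincide and have the same dimension, and distinct
  triangles have disjoint interiors. This is the usual notion of a surface obtained from
  finitely many triangles by gluing sides in pairs; two vertices, or two sides, of one triangle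
  may be identified and two triangles may have several faces in common, so that simplicial
  complexes are a special case.\<close>

definition triangulates :: "((nat \<Rightarrow> real) \<Rightarrow> 's) set \<Rightarrow> 's topology \<Rightarrow> bool" where
  "triangulates T S \<longleftrightarrow>
     finite T \<and>
     (\<forall>\<sigma>\<in>T. singular_simplex 2 S \<sigma>) \<and>
     (\<Union>\<sigma>\<in>T. \<sigma> ` standard_simplex 2) = topspace S \<and>
     (\<forall>\<sigma>\<in>T. \<forall>J\<subseteq>{..2}. J \<noteq> {} \<longrightarrow> inj_on \<sigma> (open_face J)) \<and>
     (\<forall>\<sigma>\<in>T. \<forall>\<tau>\<in>T. \<forall>J\<subseteq>{..2}. \<forall>K\<subseteq>{..2}. J \<noteq> {} \<and> K \<noteq> {} \<and>
        \<sigma> ` open_face J \<inter> \<tau> ` open_face K \<noteq> {} \<longrightarrow>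
          card J = card K \<and> \<sigma> ` open_face J = \<tau> ` open_face K \<and> (J = {..2} \<longrightarrow> \<sigma> = \<tau>))"

definition bordered_triangulated_surface ::
  "'s topology \<Rightarrow> ((nat \<Rightarrow> real) \<Rightarrow> 's) set \<Rightarrow> bool" where
  "bordered_triangulated_surface S T \<longleftrightarrow>
     compact_surface S \<and> surface_boundary S \<noteq> {} \<and> triangulates T S"

text \<open>The closed edge facing the vertex \<open>i\<close>.\<close>

definition side :: "((nat \<Rightarrow> real) \<Rightarrow> 's) \<Rightarrow> nat \<Rightarrow> 's set" where
  "side \<sigma> i = \<sigma> ` {x \<in> standard_simplex 2. x i = 0}"

definition edges :: "((nat \<Rightarrow> real) \<Rightarrow> 's) set \<Rightarrow> 's set set" where
  "edges T = {side \<sigma> i | \<sigma> i. \<sigma> \<in> T \<and> i \<le> 2}"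

definition boundary_edges :: "'s topology \<Rightarrow> ((nat \<Rightarrow> real) \<Rightarrow> 's) set \<Rightarrow> 's set set" where
  "boundary_edges S T = {e \<in> edges T. e \<subseteq> surface_boundary S}"

definition interior_edges :: "'s topology \<Rightarrow> ((nat \<Rightarrow> real) \<Rightarrow> 's) set \<Rightarrow> 's set set" where
  "interior_edges S T = edges T - boundary_edges S T"

definition stripped :: "'s topology \<Rightarrow> ((nat \<Rightarrow> real) \<Rightarrow> 's) set \<Rightarrow> bool" where
  "stripped S T \<longleftrightarrow> (\<forall>\<sigma>\<in>T. \<exists>i\<le>2. side \<sigma> i \<in> boundary_edges S T)"

section \<open>Hyperbolic triangles\<close>

text \<open>The hyperbolic plane is the upper sheet of the hyperboloid.\<close>

type_synonym point3 = "real \<times> real \<times> real"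

definition lorentz :: "point3 \<Rightarrow> point3 \<Rightarrow> real" where
  "lorentz = (\<lambda>(x1, x2, x3) (y1, y2, y3). x1 * y1 + x2 * y2 - x3 * y3)"

definition hyp_plane :: "point3 set" where
  "hyp_plane = {p. lorentz p p = -1 \<and> 0 < snd (snd p)}"

definition hyp_dist :: "point3 \<Rightarrow> point3 \<Rightarrow> real" where
  "hyp_dist A B = arcosh (- lorentz A B)"

text \<open>For \<open>A \<noteq> B\<close>, this is a tangent vector at \<open>A\<close>, i.e. Lorentz-orthogonal to \<open>A\<close>, in the
  direction of the geodesic from \<open>A\<close> to \<open>B\<close>.\<close>

definition hyp_tangent :: "point3 \<Rightarrow> point3 \<Rightarrow> point3" where
  "hyp_tangent A B = B + lorentz A B *\<^sub>R A"

definition hyp_angle :: "point3 \<Rightarrow> point3 \<Rightarrow> point3 \<Rightarrow> real" where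
  "hyp_angle A B C =
     (let u = hyp_tangent A B; v = hyp_tangent A C
      in arccos (lorentz u v / (sqrt (lorentz u u) * sqrt (lorentz v v))))"

text \<open>The inner angle facing the first side of a hyperbolic triangle with the given side
  lengths. It is well defined by the next lemma, the hyperbolic law of cosines.\<close>

definition facing_angle :: "real \<Rightarrow> real \<Rightarrow> real \<Rightarrow> real" where
  "facing_angle x y z =
     (THE \<alpha>. \<exists>A\<in>hyp_plane. \<exists>B\<in>hyp_plane. \<exists>C\<in>hyp_plane.
        hyp_dist B C = x \<and> hyp_dist C A = y \<and> hyp_dist A B = z \<and> \<alpha> = hyp_angle A B C)"

lemma lorentz_hyp_plane_le:
  assumes "A \<in> hyp_plane" "B \<in> hyp_plane"
  shows "1 \<le> - lorentz A B"
proof -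
  obtain a1 a2 a3 where A: "A = (a1, a2, a3)" by (cases A)
  obtain b1 b2 b3 where B: "B = (b1, b2, b3)" by (cases B)
  have a: "a3\<^sup>2 = 1 + a1\<^sup>2 + a2\<^sup>2" "0 < a3" and b: "b3\<^sup>2 = 1 + b1\<^sup>2 + b2\<^sup>2" "0 < b3"
    using assms by (auto simp: A B hyp_plane_def lorentz_def power2_eq_square)
  have "(a3 * b3)\<^sup>2 = (1 + a1\<^sup>2 + a2\<^sup>2) * (1 + b1\<^sup>2 + b2\<^sup>2)"
    by (simp add: a b power_mult_distrib)
  also have "\<dots> = (1 + a1 * b1 + a2 * b2)\<^sup>2 + (a1 - b1)\<^sup>2 + (a2 - b2)\<^sup>2 + (a1 * b2 - a2 * b1)\<^sup>2"
    by (simp add: power2_eq_square algebra_simps)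
  also have "\<dots> \<ge> (1 + a1 * b1 + a2 * b2)\<^sup>2"
    by simp
  finally have "1 + a1 * b1 + a2 * b2 \<le> a3 * b3"
    using a b by (meson mult_pos_pos order.strict_implies_order power2_le_imp_le)
  then show ?thesis by (simp add: A B lorentz_def)
qed

lemma hyp_angle_eq:
  assumes "A \<in> hyp_plane" "B \<in> hyp_plane" "C \<in> hyp_plane"
    and "hyp_dist B C = x" "hyp_dist C A = y" "hyp_dist A B = z" "0 < y" "0 < z"
  shows "hyp_angle A B C = arccos ((cosh y * cosh z - cosh x) / (sinh y * sinh z))"
proof -
  have comm: "lorentz p q = lorentz q p" for p q
    by (cases p; cases q) (simp add: lorentz_def)
  have AA: "lorentz A A = -1" "lorentz B B = -1" "lorentz C C = -1"
    using assms by (auto simp: hyp_plane_def)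
  have ips: "lorentz B C = - cosh x" "lorentz A C = - cosh y" "lorentz A B = - cosh z"
    using cosh_arcosh_real[OF lorentz_hyp_plane_le] assms comm unfolding hyp_dist_def
    by (metis minus_minus)+
  have tan: "lorentz (hyp_tangent A P) (hyp_tangent A Q)
      = lorentz P Q + 2 * lorentz A P * lorentz A Q + lorentz A P * lorentz A Q * lorentz A A" for P Q
    by (cases A; cases P; cases Q) (simp add: hyp_tangent_def lorentz_def algebra_simps)
  have sq: "cosh t * (cosh t * 2) - cosh t * cosh t - 1 = (sinh t)\<^sup>2" for t :: real
    using cosh_square_eq[of t] by (simp add: power2_eq_square)
  show ?thesis
    using assms(7,8) sq[of y] sq[of z]
    by (simp add: hyp_angle_def tan AA ips mult.commute)
qed

lemma facing_angle_eq:
  assumes "0 < x" "0 < y" "0 < z" "x < y + z" "y < z + x" "z < x + y"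
  shows "facing_angle x y z = arccos ((cosh y * cosh z - cosh x) / (sinh y * sinh z))"
proof -
  define c where "c = (cosh y * cosh z - cosh x) / (sinh y * sinh z)"
  define s where "s = sqrt (1 - c\<^sup>2)"
  have pos: "0 < sinh y" "0 < sinh z" using assms by auto
  have c: "sinh y * sinh z * c = cosh y * cosh z - cosh x"
    using pos by (simp add: c_def)
  have "cosh \<bar>y - z\<bar> \<le> cosh x" "cosh x \<le> cosh (y + z)"
    using assms by (subst cosh_real_nonneg_le_iff; linarith)+
  then have "cosh y * cosh z - sinh y * sinh z \<le> cosh x"
    "cosh x \<le> cosh y * cosh z + sinh y * sinh z"
    by (simp_all add: cosh_add cosh_diff)
  then have "-1 \<le> c" "c \<le> 1"
    using pos by (auto simp: c_def field_simps)
  then have cs: "c\<^sup>2 + s\<^sup>2 = 1"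
    by (simp add: s_def abs_square_le_1)
  define A B C where "A = (0 :: real, 0 :: real, 1 :: real)"
    and "B = (sinh z, 0 :: real, cosh z)" and "C = (sinh y * c, sinh y * s, cosh y)"
  have "lorentz C C = (sinh y)\<^sup>2 * (c\<^sup>2 + s\<^sup>2) - (cosh y)\<^sup>2"
    by (simp add: C_def lorentz_def power2_eq_square algebra_simps)
  then have mem: "A \<in> hyp_plane" "B \<in> hyp_plane" "C \<in> hyp_plane"
    by (auto simp: cs hyp_plane_def A_def B_def C_def lorentz_def cosh_square_eq
        simp flip: power2_eq_square)
  have "- lorentz B C = cosh x"
    using c by (simp add: B_def C_def lorentz_def algebra_simps)
  then have dist: "hyp_dist B C = x" "hyp_dist C A = y" "hyp_dist A B = z"
    using assms by (simp_all add: hyp_dist_def arcosh_cosh_real)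
      (simp_all add: A_def B_def C_def lorentz_def arcosh_cosh_real)
  show ?thesis
    unfolding facing_angle_def
  proof (rule the_equality)
    show "\<exists>A\<in>hyp_plane. \<exists>B\<in>hyp_plane. \<exists>C\<in>hyp_plane. hyp_dist B C = x \<and> hyp_dist C A = y \<and>
        hyp_dist A B = z \<and> arccos ((cosh y * cosh z - cosh x) / (sinh y * sinh z)) = hyp_angle A B C"
      using mem dist hyp_angle_eq[OF mem dist] assms by metis
  qed (use assms hyp_angle_eq in blast)
qed

section \<open>Polyhedral metrics and curvature\<close>

text \<open>Only the values of \<open>d\<close> on the edges are relevant.\<close>

definition hyp_polyhedral_metric :: "((nat \<Rightarrow> real) \<Rightarrow> 's) set \<Rightarrow> ('s set \<Rightarrow> real) \<Rightarrow> bool" where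
  "hyp_polyhedral_metric T d \<longleftrightarrow>
     (\<forall>e\<in>edges T. 0 < d e) \<and>
     (\<forall>\<sigma>\<in>T. d (side \<sigma> 0) < d (side \<sigma> 1) + d (side \<sigma> 2) \<and>
             d (side \<sigma> 1) < d (side \<sigma> 2) + d (side \<sigma> 0) \<and>
             d (side \<sigma> 2) < d (side \<sigma> 0) + d (side \<sigma> 1))"

text \<open>The angle at the vertex \<open>i\<close>, which faces the side \<open>i\<close>.\<close>

definition inner_angle :: "('s set \<Rightarrow> real) \<Rightarrow> ((nat \<Rightarrow> real) \<Rightarrow> 's) \<Rightarrow> nat \<Rightarrow> real" where
  "inner_angle d \<sigma> i =
     facing_angle (d (side \<sigma> i)) (d (side \<sigma> ((i + 1) mod 3))) (d (side \<sigma> ((i + 2) mod 3)))"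

text \<open>An interior edge is the image of exactly two sides \<open>(\<sigma>, i)\<close>, so the sum has two terms.
  The interval integral is oriented: it is negative if the angle exceeds \<open>pi / 2\<close>.\<close>

definition phi_curvature ::
  "real \<Rightarrow> ((nat \<Rightarrow> real) \<Rightarrow> 's) set \<Rightarrow> ('s set \<Rightarrow> real) \<Rightarrow> 's set \<Rightarrow> real" where
  "phi_curvature h T d e =
     (\<Sum>(\<sigma>, i)\<in>{(\<sigma>, i). \<sigma> \<in> T \<and> i \<le> 2 \<and> side \<sigma> i = e}.
        LBINT t=inner_angle d \<sigma> i..pi / 2. sin t powr h)"

end

theory Submission
  imports Defs
begin

text \<open>The proof is a maximum principle. Let \<open>e\<close> be an edge at which \<open>\<bar>d2 e - d1 e\<bar>\<close> is largest
  and suppose that this maximum is positive, say \<open>d1 e < d2 e\<close>. Then \<open>e\<close> is an interior edge,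
  because the metrics agree on the boundary. Each triangle with side \<open>e\<close> has a further side whose
  length \<open>z\<close> does not change, since the surface is stripped, and the remaining side changes by at
  most as much as \<open>e\<close>, by the choice of \<open>e\<close>. Under these conditions the angle facing \<open>e\<close> grows
  strictly (\<open>facing_angle_less\<close>). Infinitesimally, the angle \<open>a\<close> facing \<open>x\<close> satisfies
  \<open>da = k (dx - cos c dy - cos b dz)\<close> with \<open>k > 0\<close>, where \<open>b\<close> and \<open>c\<close> are the angles facing \<open>y\<close>
  and \<open>z\<close>; so \<open>da > 0\<close> if \<open>dz = 0\<close> and \<open>\<bar>dy\<bar> \<le> dx \<noteq> 0\<close>. The global version
  comes from the half-angle formula. As the angle facing \<open>e\<close> grows in every triangle at \<open>e\<close> and
  \<open>\<integral>\<^sub>a\<^bsup>pi/2\<^esup> sin\<^sup>h\<close> is strictly decreasing in \<open>a\<close> for every \<open>h\<close>, the curvature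
  at \<open>e\<close> is strictly smaller for \<open>d2\<close> than for \<open>d1\<close>, a contradiction.\<close>

section \<open>Comparison of angles in hyperbolic triangles\<close>

lemma sinh_mult_sinh_add_diff:
  fixes p q w :: real
  shows "sinh q * sinh (p + w) - sinh p * sinh (q + w) = sinh (q - p) * sinh w"
  by (simp add: sinh_add sinh_diff algebra_simps)

text \<open>Cleared of denominators, this is the monotonicity in \<open>p\<close> of \<open>sinh p / sinh (p + z)\<close> and
  \<open>sinh p / sinh (z - p)\<close>, the two factors of the half-angle formula below.\<close>

lemma sinh_mult_sinh_add_mono:
  fixes p q z :: real
  assumes "p \<le> q" "0 < z"
  shows "sinh p * sinh (q + z) \<le> sinh q * sinh (p + z)"
    and "sinh p * sinh (z - q) \<le> sinh q * sinh (z - p)"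
    and "p < q \<Longrightarrow> sinh p * sinh (q + z) < sinh q * sinh (p + z)"
    and "p < q \<Longrightarrow> sinh p * sinh (z - q) < sinh q * sinh (z - p)"
proof -
  have 1: "sinh q * sinh (p + z) - sinh p * sinh (q + z) = sinh (q - p) * sinh z"
    by (rule sinh_mult_sinh_add_diff)
  have 2: "sinh q * sinh (z - p) - sinh p * sinh (z - q) = sinh (q - p) * sinh z"
    by (simp add: sinh_diff algebra_simps)
  have "0 \<le> sinh (q - p) * sinh z" "p < q \<Longrightarrow> 0 < sinh (q - p) * sinh z"
    using assms by simp_all
  with 1 2 show "sinh p * sinh (q + z) \<le> sinh q * sinh (p + z)"
    and "sinh p * sinh (z - q) \<le> sinh q * sinh (z - p)"
    and "p < q \<Longrightarrow> sinh p * sinh (q + z) < sinh q * sinh (p + z)"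
    and "p < q \<Longrightarrow> sinh p * sinh (z - q) < sinh q * sinh (z - p)"
    by linarith+
qed

definition cos_facing_angle :: "real \<Rightarrow> real \<Rightarrow> real \<Rightarrow> real" where
  "cos_facing_angle x y z = (cosh y * cosh z - cosh x) / (sinh y * sinh z)"

lemma cos_facing_angle_half_angle:
  fixes x y z :: real
  assumes "0 < y" "0 < z"
  defines "p \<equiv> (x + y - z) / 2" and "q \<equiv> (x - y + z) / 2"
  shows "1 - cos_facing_angle x y z = 2 * (sinh p * sinh q) / (sinh y * sinh z)"
    and "1 + cos_facing_angle x y z = 2 * (sinh (p + z) * sinh (z - q)) / (sinh y * sinh z)"
proof -
  have pos: "0 < sinh y" "0 < sinh z" using assms by auto
  have prod: "2 * (sinh s * sinh t) = cosh (s + t) - cosh (s - t)" for s t :: real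
    by (simp add: cosh_add cosh_diff)
  have sums: "p + q = x" "p - q = y - z" "(p + z) + (z - q) = y + z" "(p + z) - (z - q) = x"
    by (simp_all add: p_def q_def field_simps)
  have "2 * (sinh p * sinh q) = cosh x - cosh (y - z)"
    "2 * (sinh (p + z) * sinh (z - q)) = cosh (y + z) - cosh x"
    unfolding prod sums by simp_all
  then show "1 - cos_facing_angle x y z = 2 * (sinh p * sinh q) / (sinh y * sinh z)"
    and "1 + cos_facing_angle x y z = 2 * (sinh (p + z) * sinh (z - q)) / (sinh y * sinh z)"
    using pos by (simp_all add: cos_facing_angle_def cosh_add cosh_diff field_simps)
qed

lemma cos_facing_angle_bounds:
  assumes "0 < x" "0 < y" "0 < z" "x < y + z" "y < z + x" "z < x + y"
  shows "-1 < cos_facing_angle x y z" "cos_facing_angle x y z < 1"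
proof -
  note half = cos_facing_angle_half_angle[of y z x, OF assms(2,3)]
  have "0 < 1 - cos_facing_angle x y z" "0 < 1 + cos_facing_angle x y z"
    unfolding half using assms by (simp_all add: field_simps)
  then show "-1 < cos_facing_angle x y z" "cos_facing_angle x y z < 1"
    by linarith+
qed

text \<open>By the half-angle formula, the angle \<open>a\<close> facing \<open>x\<close> satisfies
  \<open>tan\<^sup>2 (a / 2) = (sinh p / sinh (p + z)) * (sinh q / sinh (z - q))\<close> with
  \<open>p = (x + y - z) / 2\<close> and \<open>q = (x - y + z) / 2\<close>. For fixed \<open>z\<close> the two factors are strictly
  increasing in \<open>p\<close> and in \<open>q\<close>. If \<open>x\<close> grows and \<open>y\<close> changes by at most as much, then neither
  \<open>p\<close> nor \<open>q\<close> decreases, and one of them grows because \<open>p + q = x\<close>.\<close>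

lemma cos_facing_angle_less:
  assumes tri1: "0 < x1" "0 < y1" "0 < z" "x1 < y1 + z" "y1 < z + x1" "z < x1 + y1"
    and tri2: "0 < x2" "0 < y2" "x2 < y2 + z" "y2 < z + x2" "z < x2 + y2"
    and change: "x1 < x2" "\<bar>y2 - y1\<bar> \<le> x2 - x1"
  shows "cos_facing_angle x2 y2 z < cos_facing_angle x1 y1 z"
proof -
  define p1 q1 p2 q2 where "p1 = (x1 + y1 - z) / 2" and "q1 = (x1 - y1 + z) / 2"
    and "p2 = (x2 + y2 - z) / 2" and "q2 = (x2 - y2 + z) / 2"
  note defs = p1_def q1_def p2_def q2_def
  define c1 c2 where "c1 = cos_facing_angle x1 y1 z" and "c2 = cos_facing_angle x2 y2 z"
  define k1 k2 where "k1 = sinh y1 * sinh z / 2" and "k2 = sinh y2 * sinh z / 2"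
  have k: "0 < k1" "0 < k2" using assms by (simp_all add: k1_def k2_def)
  have half: "(1 - c1) * k1 = sinh p1 * sinh q1" "(1 + c1) * k1 = sinh (p1 + z) * sinh (z - q1)"
    "(1 - c2) * k2 = sinh p2 * sinh q2" "(1 + c2) * k2 = sinh (p2 + z) * sinh (z - q2)"
    using cos_facing_angle_half_angle[of y1 z x1] cos_facing_angle_half_angle[of y2 z x2] assms
    by (simp_all add: c1_def c2_def k1_def k2_def defs)
  have pos: "0 < sinh p1" "0 < sinh q1" "0 < sinh (p1 + z)" "0 < sinh (z - q1)"
    "0 < sinh p2" "0 < sinh q2" "0 < sinh (p2 + z)" "0 < sinh (z - q2)"
    using tri1 tri2 by (simp_all add: defs field_simps)
  have le: "p1 \<le> p2" "q1 \<le> q2" and lt: "p1 < p2 \<or> q1 < q2"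
    using change by (auto simp: defs field_simps abs_le_iff)
  have P: "sinh p1 * sinh (p2 + z) \<le> sinh p2 * sinh (p1 + z)"
    "p1 < p2 \<Longrightarrow> sinh p1 * sinh (p2 + z) < sinh p2 * sinh (p1 + z)"
    by (rule sinh_mult_sinh_add_mono; use le tri1 in simp)+
  have Q: "sinh q1 * sinh (z - q2) \<le> sinh q2 * sinh (z - q1)"
    "q1 < q2 \<Longrightarrow> sinh q1 * sinh (z - q2) < sinh q2 * sinh (z - q1)"
    by (rule sinh_mult_sinh_add_mono; use le tri1 in simp)+
  have prods: "0 < sinh p1 * sinh (p2 + z)" "0 < sinh q1 * sinh (z - q2)"
    by (rule mult_pos_pos; rule pos)+
  have "(sinh p1 * sinh (p2 + z)) * (sinh q1 * sinh (z - q2))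
      < (sinh p2 * sinh (p1 + z)) * (sinh q2 * sinh (z - q1))"
    using lt
  proof
    assume "p1 < p2"
    from mult_less_le_imp_less[OF P(2)[OF this] Q(1)] prods show ?thesis by linarith
  next
    assume "q1 < q2"
    from mult_le_less_imp_less[OF P(1) Q(2)[OF this]] prods show ?thesis by linarith
  qed
  then have "((1 - c1) * k1) * ((1 + c2) * k2) < ((1 - c2) * k2) * ((1 + c1) * k1)"
    unfolding half by (simp add: ac_simps)
  then have "(k1 * k2) * ((1 - c1) * (1 + c2)) < (k1 * k2) * ((1 - c2) * (1 + c1))"
    by (simp add: ac_simps)
  \<comment> \<open>The products \<open>c1 * c2\<close> cancel, which leaves a linear inequality.\<close>
  then have "(1 - c1) * (1 + c2) < (1 - c2) * (1 + c1)"
    using k by (simp add: mult_less_cancel_left_pos)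
  then show ?thesis
    by (simp add: c1_def c2_def algebra_simps)
qed

lemma facing_angle_eq_arccos:
  assumes "0 < x" "0 < y" "0 < z" "x < y + z" "y < z + x" "z < x + y"
  shows "facing_angle x y z = arccos (cos_facing_angle x y z)"
  using facing_angle_eq[OF assms] by (simp add: cos_facing_angle_def)

lemma facing_angle_commute:
  assumes "0 < x" "0 < y" "0 < z" "x < y + z" "y < z + x" "z < x + y"
  shows "facing_angle x y z = facing_angle x z y"
  using assms by (simp add: facing_angle_eq ac_simps)

lemma facing_angle_bounds:
  assumes "0 < x" "0 < y" "0 < z" "x < y + z" "y < z + x" "z < x + y"
  shows "0 < facing_angle x y z" "facing_angle x y z < pi"
  using arccos_lt_bounded[OF cos_facing_angle_bounds[OF assms]] facing_angle_eq_arccos[OF assms]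
  by simp_all

lemma facing_angle_less:
  assumes tri1: "0 < x1" "0 < y1" "0 < z" "x1 < y1 + z" "y1 < z + x1" "z < x1 + y1"
    and tri2: "0 < x2" "0 < y2" "x2 < y2 + z" "y2 < z + x2" "z < x2 + y2"
    and change: "x1 < x2" "\<bar>y2 - y1\<bar> \<le> x2 - x1"
  shows "facing_angle x1 y1 z < facing_angle x2 y2 z"
proof -
  have "arccos (cos_facing_angle x1 y1 z) < arccos (cos_facing_angle x2 y2 z)"
    using cos_facing_angle_less[OF assms] cos_facing_angle_bounds[OF tri1]
      cos_facing_angle_bounds[of x2 y2 z] tri1(3) tri2
    by (intro arccos_less_arccos) auto
  then show ?thesis
    using facing_angle_eq_arccos[OF tri1] facing_angle_eq_arccos[of x2 y2 z] tri1(3) tri2 by simp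
qed

section \<open>Angles and curvature of a polyhedral metric\<close>

lemma integral_sin_powr_strict_antimono:
  fixes a b h :: real
  assumes "0 < a" "a < b" "b < pi"
  shows "(LBINT t=b..pi / 2. sin t powr h) < (LBINT t=a..pi / 2. sin t powr h)"
proof -
  \<comment> \<open>The integrand may be singular at \<open>0\<close> and \<open>pi\<close>, so the base point \<open>pi / 2\<close> and both
    arguments are enclosed in a compact interval inside \<open>]0, pi[\<close>.\<close>
  define l r where "l = min a (pi / 2)" and "r = max b (pi / 2)"
  define G where "G u = (LBINT t=pi / 2..u. sin t powr h)" for u :: real
  have lr: "0 < l" "l \<le> pi / 2" "pi / 2 \<le> r" "r < pi" "l \<le> a" "b \<le> r"
    using assms by (auto simp: l_def r_def)
  have cont: "continuous_on {l..r} (\<lambda>t. sin t powr h)"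
  proof (intro continuous_intros ballI)
    fix t assume "t \<in> {l..r}"
    then have "0 < sin t" using lr by (intro sin_gt_zero) auto
    then show "sin t \<noteq> 0" by simp
  qed
  have deriv: "(G has_vector_derivative (sin u powr h)) (at u within {l..r})"
    if "l \<le> u" "u \<le> r" for u
    unfolding G_def using interval_integral_FTC2[OF lr(2,3) cont that] .
  have "G a < G b"
  proof (rule DERIV_pos_imp_increasing_open[OF assms(2)])
    fix u assume u: "a < u" "u < b"
    then have "u \<in> interior {l..r}" using lr by simp
    then have "(G has_real_derivative (sin u powr h)) (at u)"
      using deriv[of u] u lr at_within_interior[of u "{l..r}"]
      unfolding has_real_derivative_iff_has_vector_derivative by simp
    moreover have "0 < sin u powr h"
      using sin_gt_zero[of u] u assms by simp
    ultimately show "\<exists>y. (G has_real_derivative y) (at u) \<and> 0 < y" by blast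
  next
    have "continuous_on {l..r} G"
      unfolding continuous_on_eq_continuous_within
      by (auto intro: has_vector_derivative_continuous[OF deriv])
    then show "continuous_on {a..b} G"
      by (rule continuous_on_subset) (use lr in auto)
  qed
  then show ?thesis
    using interval_integral_endpoints_reverse[of "ereal a" "ereal (pi / 2)" "\<lambda>t. sin t powr h"]
      interval_integral_endpoints_reverse[of "ereal b" "ereal (pi / 2)" "\<lambda>t. sin t powr h"]
    by (simp add: G_def)
qed

lemma three_indices_cases:
  assumes "{i, j, k} = {..2::nat}"
  obtains "i = 0" "j = 1" "k = 2" | "i = 1" "j = 2" "k = 0" | "i = 2" "j = 0" "k = 1"
    | "i = 0" "j = 2" "k = 1" | "i = 1" "j = 0" "k = 2" | "i = 2" "j = 1" "k = 0"
proof -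
  have "card {i, j, k} = 3" using assms by simp
  then have "i \<noteq> j" "i \<noteq> k" "j \<noteq> k" by (auto simp: card_insert_if split: if_splits)
  moreover have "{..2} = {0, 1, 2::nat}" by auto
  then have "i \<in> {0, 1, 2}" "j \<in> {0, 1, 2}" "k \<in> {0, 1, 2}"
    using assms by blast+
  ultimately have "(i, j, k) \<in> {(0, 1, 2), (1, 2, 0), (2, 0, 1), (0, 2, 1), (1, 0, 2), (2, 1, 0)}"
    by auto
  then show thesis using that by auto
qed

lemma hyp_polyhedral_metric_triangle:
  assumes "hyp_polyhedral_metric T d" "\<sigma> \<in> T" "{i, j, k} = {..2}"
  shows "0 < d (side \<sigma> i)" "0 < d (side \<sigma> j)" "0 < d (side \<sigma> k)"
    and "d (side \<sigma> i) < d (side \<sigma> j) + d (side \<sigma> k)"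
      "d (side \<sigma> j) < d (side \<sigma> k) + d (side \<sigma> i)"
      "d (side \<sigma> k) < d (side \<sigma> i) + d (side \<sigma> j)"
proof -
  have "i \<le> 2" "j \<le> 2" "k \<le> 2" using assms(3) by blast+
  then show "0 < d (side \<sigma> i)" "0 < d (side \<sigma> j)" "0 < d (side \<sigma> k)"
    using assms(1,2) by (auto simp: hyp_polyhedral_metric_def edges_def)
  have tri: "d (side \<sigma> 0) < d (side \<sigma> 1) + d (side \<sigma> 2)"
    "d (side \<sigma> 1) < d (side \<sigma> 2) + d (side \<sigma> 0)"
    "d (side \<sigma> 2) < d (side \<sigma> 0) + d (side \<sigma> 1)"
    using assms(1,2) by (auto simp: hyp_polyhedral_metric_def)
  have "d (side \<sigma> i) < d (side \<sigma> j) + d (side \<sigma> k) \<and>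
      d (side \<sigma> j) < d (side \<sigma> k) + d (side \<sigma> i) \<and>
      d (side \<sigma> k) < d (side \<sigma> i) + d (side \<sigma> j)"
    by (rule three_indices_cases[OF assms(3)]; hypsubst; use tri in linarith)
  then show "d (side \<sigma> i) < d (side \<sigma> j) + d (side \<sigma> k)"
      "d (side \<sigma> j) < d (side \<sigma> k) + d (side \<sigma> i)"
      "d (side \<sigma> k) < d (side \<sigma> i) + d (side \<sigma> j)"
    by blast+
qed

text \<open>The two other sides may be listed in either order, which lets the side of fixed length
  stand last.\<close>

lemma inner_angle_eq:
  assumes "hyp_polyhedral_metric T d" "\<sigma> \<in> T" "{i, j, k} = {..2}"
  shows "inner_angle d \<sigma> i = facing_angle (d (side \<sigma> i)) (d (side \<sigma> j)) (d (side \<sigma> k))"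
proof -
  have "(j = (i + 1) mod 3 \<and> k = (i + 2) mod 3) \<or> (k = (i + 1) mod 3 \<and> j = (i + 2) mod 3)"
    by (rule three_indices_cases[OF assms(3)]) simp_all
  then show ?thesis
    using facing_angle_commute[OF hyp_polyhedral_metric_triangle[OF assms]]
    unfolding inner_angle_def by metis
qed

lemma inner_angle_bounds:
  assumes "hyp_polyhedral_metric T d" "\<sigma> \<in> T" "{i, j, k} = {..2}"
  shows "0 < inner_angle d \<sigma> i" "inner_angle d \<sigma> i < pi"
  using facing_angle_bounds[OF hyp_polyhedral_metric_triangle[OF assms]]
  by (simp_all add: inner_angle_eq[OF assms])

lemma inner_angle_less:
  assumes d1: "hyp_polyhedral_metric T d1" and d2: "hyp_polyhedral_metric T d2"
    and \<sigma>: "\<sigma> \<in> T" "{i, j, k} = {..2}"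
    and fixed: "d1 (side \<sigma> k) = d2 (side \<sigma> k)"
    and change: "d1 (side \<sigma> i) < d2 (side \<sigma> i)"
      "\<bar>d2 (side \<sigma> j) - d1 (side \<sigma> j)\<bar> \<le> d2 (side \<sigma> i) - d1 (side \<sigma> i)"
  shows "inner_angle d1 \<sigma> i < inner_angle d2 \<sigma> i"
  unfolding inner_angle_eq[OF d1 \<sigma>] inner_angle_eq[OF d2 \<sigma>] fixed[symmetric]
  by (rule facing_angle_less[OF hyp_polyhedral_metric_triangle[OF d1 \<sigma>]])
    (use hyp_polyhedral_metric_triangle[OF d2 \<sigma>] fixed change in simp_all)

section \<open>The maximum principle\<close>

text \<open>At an edge of maximal change every adjacent triangle satisfies the hypotheses of
  \<open>inner_angle_less\<close>: its boundary side is the side of fixed length, and maximality bounds the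
  change of the third side. Hence each summand of the curvature decreases. A triangle that has \<open>e\<close>
  as two of its sides is covered as well, because the third side may then change exactly as
  much as \<open>e\<close>.\<close>

lemma phi_curvature_less_at_maximal_increase:
  assumes T: "finite T" "stripped S T"
    and d1: "hyp_polyhedral_metric T d1" and d2: "hyp_polyhedral_metric T d2"
    and bdry: "\<forall>e\<in>boundary_edges S T. d1 e = d2 e"
    and e: "e \<in> edges T" "d1 e < d2 e"
    and max: "\<forall>e'\<in>edges T. \<bar>d2 e' - d1 e'\<bar> \<le> d2 e - d1 e"
  shows "phi_curvature h T d2 e < phi_curvature h T d1 e"
proof -
  let ?I = "{(\<sigma>, i). \<sigma> \<in> T \<and> i \<le> 2 \<and> side \<sigma> i = e}"
  have "?I \<subseteq> T \<times> {..2}" by auto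
  then have "finite ?I" using T(1) by (simp add: finite_subset)
  moreover have "?I \<noteq> {}" using e(1) by (auto simp: edges_def)
  moreover have "(LBINT t=inner_angle d2 \<sigma> i..pi / 2. sin t powr h)
      < (LBINT t=inner_angle d1 \<sigma> i..pi / 2. sin t powr h)"
    if side: "\<sigma> \<in> T" "i \<le> 2" "side \<sigma> i = e" for \<sigma> i
  proof -
    obtain k where k: "k \<le> 2" "side \<sigma> k \<in> boundary_edges S T"
      using T(2) side(1) by (auto simp: stripped_def)
    then have fixed: "d1 (side \<sigma> k) = d2 (side \<sigma> k)" using bdry by blast
    with e(2) side(3) have "i \<noteq> k" by auto
    have three: "{..2} = {0, 1, 2::nat}" by auto
    then have "i \<in> {0, 1, 2}" "k \<in> {0, 1, 2}" using side(2) k(1) by blast+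
    with \<open>i \<noteq> k\<close> have "{i, 3 - i - k, k} = {..2}" unfolding three by auto
    then obtain j where ijk: "{i, j, k} = {..2}" ..
    then have "j \<le> 2" by blast
    then have "side \<sigma> j \<in> edges T" using side(1) by (auto simp: edges_def)
    then have "inner_angle d1 \<sigma> i < inner_angle d2 \<sigma> i"
      using inner_angle_less[OF d1 d2 side(1) ijk fixed] e(2) max side(3) by blast
    then show ?thesis
      using inner_angle_bounds[OF d1 side(1) ijk] inner_angle_bounds[OF d2 side(1) ijk]
      by (intro integral_sin_powr_strict_antimono)
  qed
  ultimately show ?thesis
    unfolding phi_curvature_def by (intro sum_strict_mono) auto
qed

theorem theorem1p9:
  fixes S :: "'s topology" and T :: "((nat \<Rightarrow> real) \<Rightarrow> 's) set"
    and h :: real and d1 d2 :: "'s set \<Rightarrow> real"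
  assumes "bordered_triangulated_surface S T"
    and "connected_space S"
    and "stripped S T"
    and "hyp_polyhedral_metric T d1"
    and "hyp_polyhedral_metric T d2"
    and "\<forall>e\<in>boundary_edges S T. d1 e = d2 e"
    and "\<forall>e\<in>interior_edges S T. phi_curvature h T d1 e = phi_curvature h T d2 e"
  shows "\<forall>e\<in>edges T. d1 e = d2 e"
proof (rule ccontr)
  assume "\<not> ?thesis"
  then obtain e0 where e0: "e0 \<in> edges T" "d1 e0 \<noteq> d2 e0" by blast
  have fin: "finite T"
    using assms(1) by (simp add: bordered_triangulated_surface_def triangulates_def)
  have "edges T = (\<lambda>(\<sigma>, i). side \<sigma> i) ` (T \<times> {..2})"
    by (auto simp: edges_def image_def)
  then have "finite (edges T)" using fin by simp
  then obtain e where e: "e \<in> edges T"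
    and max_e: "\<bar>d2 e - d1 e\<bar> = (MAX e\<in>edges T. \<bar>d2 e - d1 e\<bar>)"
    using e0(1) obtains_MAX[of "edges T" "\<lambda>e. \<bar>d2 e - d1 e\<bar>"] by (metis empty_iff)
  have max: "\<forall>e'\<in>edges T. \<bar>d2 e' - d1 e'\<bar> \<le> \<bar>d2 e - d1 e\<bar>"
    unfolding max_e using \<open>finite (edges T)\<close> by simp
  have ne: "d1 e \<noteq> d2 e"
    using max e0 by force
  then have "e \<in> interior_edges S T"
    using e assms(6) by (auto simp: interior_edges_def)
  then have eq: "phi_curvature h T d1 e = phi_curvature h T d2 e"
    using assms(7) by blast
  consider "d1 e < d2 e" | "d2 e < d1 e" using ne by linarith
  then show False
  proof cases
    case 1
    have "phi_curvature h T d2 e < phi_curvature h T d1 e"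
      by (rule phi_curvature_less_at_maximal_increase[OF fin assms(3-6) e 1]) (use max 1 in simp)
    then show False using eq by simp
  next
    case 2
    have "phi_curvature h T d1 e < phi_curvature h T d2 e"
      by (rule phi_curvature_less_at_maximal_increase[OF fin assms(3,5,4) _ e 2])
        (use max 2 assms(6) in \<open>simp_all add: abs_minus_commute\<close>)
    then show False using eq by simp
  qed
qed

end
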